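(* Consider the predictive queueing system described in the context, with users $n=1,\dots,N$ and prediction window sizes $D_1,\dots,D_N$. For each user $n$, let $\hat Q_n(t)$ be the queue size of a single-queue system that (i) has initial size $\hat Q_n(0)=\sum_{t=0}^{D_n-1}A_n(t)$, (ii) uses no prediction, (iii) has arrivals $\hat A_n(t)=A_n(t+D_n)$, (iv) has service $\hat\mu_n(t)=\sum_{d=-1}^{D_n-1}\mu_n^{(d)}(t)$, and (v) evolves according to $$\hat Q_n(t+1)=\big[\hat Q_n(t)-\hat\mu_n(t)\big]^+ +\hat A_n(t).$$ If the predictive system uses a fully-efficient predictive scheduling policy (with any queueing discipline), then for all $t\ge 0$, $$Q_n^{\mathrm{sum}}(t)=\hat Q_n(t)\qquad\text{for all } n.$$
   Context: Time is slotted, $t\in\{0,1,2,\dots\}$, and $[x]^+=\max(x,0)$. There are $N$ users served by one server. $A_n(t)$ is the number of packets of user $n$ arriving in slot $t$, with $0\le A_n(t)\le A_{\max}$. $\mu_n(t)\ge 0$ is the total service rate allocated to user $n$ in slot $t$. User $n$ has a prediction window of size $D_n\ge 0$ (an integer): at time $t$ the server knows $A_n(t),\dots,A_n(t+D_n-1)$ and may serve these future arrivals in the current slot. $\mu_n^{(d)}(t)\ge 0$, $0\le d\le D_n-1$, is the rate allocated in slot $t$ to the packets arriving in slot $t+d$, and $\mu_n^{(-1)}(t)\ge 0$ is the rate allocated to packets already in the system; $\sum_{d=-1}^{D_n-1}\mu_n^{(d)}(t)\le\mu_n(t)$. Prediction queues: for $0\le d\le D_n-1$, $Q_n^{(d)}(t)$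 is the number of not-yet-served packets among the arrivals of slot $t+d$; $Q_n^{(-1)}(t)$ is the actual backlog in the system. Initially $Q_n^{(-1)}(0)=0$ and $Q_n^{(d)}(0)=A_n(d)$ for $0\le d\le D_n-1$. They evolve by - $Q_n^{(D_n-1)}(t+1)=A_n(t+D_n)$; - $Q_n^{(d)}(t+1)=[Q_n^{(d+1)}(t)-\mu_n^{(d+1)}(t)]^+$ for $0\le d\le D_n-2$; - $Q_n^{(-1)}(t+1)=[Q_n^{(-1)}(t)-\mu_n^{(-1)}(t)]^+ +[Q_n^{(0)}(t)-\mu_n^{(0)}(t)]^+$. If $D_n=0$ (no prediction) there is only $Q_n^{(-1)}(t)$, with $Q_n^{(-1)}(t+1)=[Q_n^{(-1)}(t)-\mu_n^{(-1)}(t)]^+ +A_n(t)$. Define $Q_n^{\mathrm{sum}}(t)=\sum_{d=-1}^{D_n-1}Q_n^{(d)}(t)$. A predictive scheduling policy is fully-efficient if for every user $n$ and every $t$: (i) $\sum_{d=-1}^{D_n-1}\mu_n^{(d)}(t)=\mu_n(t)$; and (ii) whenever there exists $d$ with $\mu_n^{(d)}(t)>Q_n^{(d)}(t)$, then $\mu_n^{(d')}(t)\ge Q_n^{(d')}(t)$ for all $d'\ne d$. A queueing discipline is a rule for choosing which packets to serve. *)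

theory Defs
  imports Complex_Main
begin

text \<open>
  Conventions: \<open>D n\<close> is the window of user \<open>n\<close>, \<open>A n t\<close> its arrivals in slot \<open>t\<close>, \<open>\<mu> n t\<close> its
  total service rate and \<open>\<nu> n d t\<close> the rate \<open>\<mu>\<^sub>n\<^sup>(\<^sup>d\<^sup>)(t)\<close> allocated to its queue \<open>d\<close>.
  Queue indices are integers because \<open>d = -1\<close> denotes the packets already in the system.
\<close>

definition queue_indices :: "nat \<Rightarrow> int set" where
  "queue_indices w = {-1..int w - 1}"

text \<open>
  \<open>prediction_queue D A \<nu> n d t\<close> is \<open>Q\<^sub>n\<^sup>(\<^sup>d\<^sup>)(t)\<close>. The value 0 outside \<open>queue_indices (D n)\<close> is a
  dummy. For \<open>D n = 0\<close> the index \<open>-1\<close> is also \<open>D n - 1\<close>, so \<open>d = -1\<close> is tested first.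
\<close>

primrec prediction_queue ::
  "(nat \<Rightarrow> nat) \<Rightarrow> (nat \<Rightarrow> nat \<Rightarrow> real) \<Rightarrow> (nat \<Rightarrow> int \<Rightarrow> nat \<Rightarrow> real) \<Rightarrow> nat \<Rightarrow> int \<Rightarrow> nat \<Rightarrow> real" where
  "prediction_queue D A \<nu> n d 0 =
     (if d \<in> {0..int (D n) - 1} then A n (nat d) else 0)"
| "prediction_queue D A \<nu> n d (Suc t) =
     (if d = -1 then
        max (prediction_queue D A \<nu> n (-1) t - \<nu> n (-1) t) 0
        + (if D n = 0 then A n t
           else max (prediction_queue D A \<nu> n 0 t - \<nu> n 0 t) 0)
      else if d = int (D n) - 1 then A n (t + D n)
      else if d \<in> {0..int (D n) - 2} then
        max (prediction_queue D A \<nu> n (d + 1) t - \<nu> n (d + 1) t) 0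
      else 0)"

definition Q_sum ::
  "(nat \<Rightarrow> nat) \<Rightarrow> (nat \<Rightarrow> nat \<Rightarrow> real) \<Rightarrow> (nat \<Rightarrow> int \<Rightarrow> nat \<Rightarrow> real) \<Rightarrow> nat \<Rightarrow> nat \<Rightarrow> real" where
  "Q_sum D A \<nu> n t = (\<Sum>d\<in>queue_indices (D n). prediction_queue D A \<nu> n d t)"

primrec single_queue :: "real \<Rightarrow> (nat \<Rightarrow> real) \<Rightarrow> (nat \<Rightarrow> real) \<Rightarrow> nat \<Rightarrow> real" where
  "single_queue q a s 0 = q"
| "single_queue q a s (Suc t) = max (single_queue q a s t - s t) 0 + a t"

definition Q_hat ::
  "(nat \<Rightarrow> nat) \<Rightarrow> (nat \<Rightarrow> nat \<Rightarrow> real) \<Rightarrow> (nat \<Rightarrow> int \<Rightarrow> nat \<Rightarrow> real) \<Rightarrow> nat \<Rightarrow> nat \<Rightarrow> real" where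
  "Q_hat D A \<nu> n =
     single_queue (\<Sum>t<D n. A n t) (\<lambda>t. A n (t + D n)) (\<lambda>t. \<Sum>d\<in>queue_indices (D n). \<nu> n d t)"

definition bounded_arrivals :: "nat \<Rightarrow> real \<Rightarrow> (nat \<Rightarrow> nat \<Rightarrow> real) \<Rightarrow> bool" where
  "bounded_arrivals N A_max A \<longleftrightarrow> (\<forall>n\<in>{1..N}. \<forall>t. 0 \<le> A n t \<and> A n t \<le> A_max)"

text \<open>
  A policy is represented by the rates it realizes along the given sample path of arrivals. The
  queueing discipline only selects which packets these rates serve; since the rates are otherwise
  arbitrary, quantifying over them covers every discipline.
\<close>

definition predictive_scheduling ::
  "nat \<Rightarrow> (nat \<Rightarrow> nat) \<Rightarrow> (nat \<Rightarrow> nat \<Rightarrow> real) \<Rightarrow> (nat \<Rightarrow> int \<Rightarrow> nat \<Rightarrow> real) \<Rightarrow> bool" where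
  "predictive_scheduling N D \<mu> \<nu> \<longleftrightarrow>
     (\<forall>n\<in>{1..N}. \<forall>t.
        0 \<le> \<mu> n t \<and>
        (\<forall>d\<in>queue_indices (D n). 0 \<le> \<nu> n d t) \<and>
        (\<Sum>d\<in>queue_indices (D n). \<nu> n d t) \<le> \<mu> n t)"

definition fully_efficient ::
  "nat \<Rightarrow> (nat \<Rightarrow> nat) \<Rightarrow> (nat \<Rightarrow> nat \<Rightarrow> real) \<Rightarrow> (nat \<Rightarrow> nat \<Rightarrow> real) \<Rightarrow>
   (nat \<Rightarrow> int \<Rightarrow> nat \<Rightarrow> real) \<Rightarrow> bool" where
  "fully_efficient N D A \<mu> \<nu> \<longleftrightarrow>
     (\<forall>n\<in>{1..N}. \<forall>t.
        (\<Sum>d\<in>queue_indices (D n). \<nu> n d t) = \<mu> n t \<and>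
        (\<forall>d\<in>queue_indices (D n). \<nu> n d t > prediction_queue D A \<nu> n d t \<longrightarrow>
           (\<forall>d'\<in>queue_indices (D n) - {d}. \<nu> n d' t \<ge> prediction_queue D A \<nu> n d' t)))"

end

theory Submission
  imports Defs
begin

text \<open>
  Each queue first loses its service, then shifts by one index, and the slot \<open>t + D\<close> enters the
  window. So the total backlog follows the recursion of the single queue, provided that truncation
  at 0 commutes with summation over the queues. Full efficiency gives exactly this: either no
  queue is over-served, or every queue is emptied.
\<close>

text \<open>If some \<open>d\<close> has \<open>q d < s d\<close>, the hypothesis bounds every other
  entry as well, so all truncated terms vanish, and so does the right side because
  \<open>sum q I\<close> is at most \<open>sum s I\<close>. Otherwise no truncation takes effect on
  either side.\<close>

lemma sum_max_diff_0:
  fixes q s :: "'a \<Rightarrow> real"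
  assumes "\<And>d d'. d \<in> I \<Longrightarrow> d' \<in> I \<Longrightarrow> d' \<noteq> d \<Longrightarrow> q d < s d \<Longrightarrow> q d' \<le> s d'"
  shows "(\<Sum>d\<in>I. max (q d - s d) 0) = max (sum q I - sum s I) 0"
proof (cases "\<exists>d\<in>I. q d < s d")
  case True
  then have le: "q d \<le> s d" if "d \<in> I" for d
    using assms that by (metis less_imp_le)
  then have "(\<Sum>d\<in>I. max (q d - s d) 0) = 0"
    by (intro sum.neutral) auto
  with sum_mono[of I q s] le show ?thesis by simp
next
  case False
  then have le: "s d \<le> q d" if "d \<in> I" for d
    using that by (meson not_less)
  then have "(\<Sum>d\<in>I. max (q d - s d) 0) = (\<Sum>d\<in>I. q d - s d)"
    by (intro sum.cong) auto
  with sum_mono[of I s q] le show ?thesis by (simp add: sum_subtractf)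
qed

lemma Q_sum_0: "Q_sum D A \<nu> n 0 = (\<Sum>t<D n. A n t)"
proof -
  have "Q_sum D A \<nu> n 0 = (\<Sum>d\<in>{0..int (D n) - 1}. A n (nat d))"
    \<comment> \<open>Index -1 drops out, since the system starts empty.\<close>
    unfolding Q_sum_def queue_indices_def by (rule sum.mono_neutral_cong_right) auto
  also have "\<dots> = (\<Sum>t<D n. A n t)"
    by (rule sum.reindex_bij_witness[of _ int nat]) auto
  finally show ?thesis .
qed

lemma Q_sum_Suc:
  "Q_sum D A \<nu> n (Suc t) =
     (\<Sum>d\<in>queue_indices (D n). max (prediction_queue D A \<nu> n d t - \<nu> n d t) 0) + A n (t + D n)"
proof (cases "D n = 0")
  \<comment> \<open>With an empty window, the arrivals of slot \<open>t\<close> go straight into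
    queue -1.\<close>
  case True
  then show ?thesis by (simp add: Q_sum_def queue_indices_def)
next
  case False
  let ?Q = "prediction_queue D A \<nu> n"
  let ?r = "\<lambda>d. max (?Q d t - \<nu> n d t) 0"
  let ?w = "int (D n)"
  \<comment> \<open>The same index set split in two ways: \<open>new\<close> follows the cases of
    the recursion at \<open>Suc t\<close>, while \<open>old\<close> sets apart -1 and 0, whose
    remainders merge into queue -1. For \<open>D n = 1\<close> both intervals are empty.\<close>
  have new: "queue_indices (D n) = insert (-1) (insert (?w - 1) {0..?w - 2})"
    and old: "queue_indices (D n) = insert (-1) (insert 0 {1..?w - 1})"
    using False by (auto simp: queue_indices_def)
  have "(\<Sum>d\<in>{0..?w - 2}. ?Q d (Suc t)) = (\<Sum>d\<in>{0..?w - 2}. ?r (d + 1))"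
    by (rule sum.cong) auto
  also have "\<dots> = (\<Sum>d\<in>{1..?w - 1}. ?r d)"
    by (rule sum.reindex_bij_witness[of _ "\<lambda>d. d - 1" "\<lambda>d. d + 1"]) auto
  finally have shift: "(\<Sum>d\<in>{0..?w - 2}. ?Q d (Suc t)) = (\<Sum>d\<in>{1..?w - 1}. ?r d)" .
  have "Q_sum D A \<nu> n (Suc t) =
      ?Q (-1) (Suc t) + (?Q (?w - 1) (Suc t) + (\<Sum>d\<in>{0..?w - 2}. ?Q d (Suc t)))"
    unfolding Q_sum_def new using False by (simp del: prediction_queue.simps)
  also have "\<dots> = (\<Sum>d\<in>queue_indices (D n). ?r d) + A n (t + D n)"
    unfolding shift old using False by simp
  finally show ?thesis .
qed

theorem theorem3:
  fixes N :: nat and D :: "nat \<Rightarrow> nat" and A :: "nat \<Rightarrow> nat \<Rightarrow> real" and A_max :: real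
    and \<mu> :: "nat \<Rightarrow> nat \<Rightarrow> real" and \<nu> :: "nat \<Rightarrow> int \<Rightarrow> nat \<Rightarrow> real"
  assumes "bounded_arrivals N A_max A"
    and "predictive_scheduling N D \<mu> \<nu>"
    and "fully_efficient N D A \<mu> \<nu>"
  shows "\<forall>t. \<forall>n\<in>{1..N}. Q_sum D A \<nu> n t = Q_hat D A \<nu> n t"
proof (intro allI ballI)
  fix t n assume n: "n \<in> {1..N}"
  show "Q_sum D A \<nu> n t = Q_hat D A \<nu> n t"
  proof (induction t)
    case 0
    show ?case by (simp add: Q_sum_0 Q_hat_def)
  next
    case (Suc t)
    \<comment> \<open>Condition (ii) of full efficiency is the hypothesis of
      \<open>sum_max_diff_0\<close> for the queues at time \<open>t\<close>.\<close>
    have "(\<Sum>d\<in>queue_indices (D n). max (prediction_queue D A \<nu> n d t - \<nu> n d t) 0) =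
        max (Q_sum D A \<nu> n t - (\<Sum>d\<in>queue_indices (D n). \<nu> n d t)) 0"
      unfolding Q_sum_def
      by (rule sum_max_diff_0) (use assms(3) n in \<open>auto simp: fully_efficient_def\<close>)
    with Suc show ?case
      by (simp add: Q_sum_Suc Q_hat_def)
  qed
qed

end
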